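(* Let $m:\mathcal{A}\to[0,+\infty)$ be a complete $\sigma$-additive measure of finite variation, and let $f:T\to\mathbb{R}$ be a bounded function. Then $f$ is Gould $m$-integrable on $T$ if and only if $f$ is Riemann-Lebesgue $m$-integrable on $T$, and in this case the two integrals coincide.
   Context: $T$ is a nonempty, at least countable (i.e. infinite) set and $\mathcal{A}$ is a $\sigma$-algebra of subsets of $T$. The variation of $m$ is $\overline{m}(E)=\sup\{\sum_{i=1}^n m(A_i)\}$ for $E\subseteq T$, the supremum being over finite families of pairwise disjoint sets $A_i\in\mathcal{A}$ with $A_i\subseteq E$; $m$ is of finite variation if $\overline{m}(T)<+\infty$. A finite (respectively countable) partition of $T$ is a finite (respectively at most countable) family of pairwise disjoint nonempty sets of $\mathcal{A}$ with union $T$. For partitions $P,P'$ of $T$, write $P'\ge P$ if every set of $P'$ is included in some set of $P$. A function $f:T\to\mathbb{R}$ is Riemann-Lebesgue $m$-integrable on $T$ if there is $b\in\mathbb{R}$ such that for every $\varepsilon>0$ there is a countable partition $P_\varepsilon$ of $T$ such that for every countable partition $P=\{A_n\}$ of $T$ with $P\ge P_\varepsilon$: $f$ is bounded on every $A_n$ with $m(A_n)>0$, and for every choice of points $t_n\in A_n$ the series $\sum_n f(t_n)m(A_n)$ is absolutely convergent and $|\sum_n f(t_n)m(A_n)-b|<\varepsilon$. The number $b$ is unique and is the Riemann-Lebesgue integral of $f$. A function $f:T\to\mathbb{R}$ is Gould $m$-integrable on $T$ if there is $a\in\mathbb{R}$ such that for every $\varepsilon>0$ there is a finite partition $P_\varepsilon$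 of $T$ such that for every finite partition $P=\{A_i\}_{i=1,\dots,n}$ of $T$ with $P\ge P_\varepsilon$ and every choice $t_i\in A_i$ one has $|\sum_{i=1}^n f(t_i)m(A_i)-a|<\varepsilon$. The number $a$ is the Gould integral of $f$, denoted $(G)\int_T f\,dm$. *)

theory Defs
  imports "HOL-Analysis.Analysis"
begin

text \<open>
  The notions below are defined for an arbitrary nonnegative set function \<open>m\<close> on a family
  \<open>\<A>\<close> of subsets of \<open>T\<close>, which need not be additive.  Values of \<open>m\<close> outside \<open>\<A>\<close>
  and of \<open>f\<close> outside \<open>T\<close> are never used.
\<close>

definition variation :: "'a set set \<Rightarrow> ('a set \<Rightarrow> real) \<Rightarrow> 'a set \<Rightarrow> ereal" where
  "variation \<A> m E =
     Sup {ereal (\<Sum>i<n. m (A i)) | n A.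
            (\<forall>i<n. A i \<in> \<A> \<and> A i \<subseteq> E) \<and> disjoint_family_on A {..<(n::nat)}}"

definition finite_variation :: "'a set \<Rightarrow> 'a set set \<Rightarrow> ('a set \<Rightarrow> real) \<Rightarrow> bool" where
  "finite_variation T \<A> m \<longleftrightarrow> variation \<A> m T < \<infinity>"

text \<open>
  The members of a partition are nonempty and pairwise disjoint, hence distinct, so a partition is
  represented by the set of its members, and a choice of points \<open>t\<^sub>n \<in> A\<^sub>n\<close> by a function
  \<open>t\<close> on sets with \<open>t A \<in> A\<close>.
\<close>

definition finite_partition :: "'a set \<Rightarrow> 'a set set \<Rightarrow> 'a set set \<Rightarrow> bool" where
  "finite_partition T \<A> P \<longleftrightarrow> finite P \<and> P \<subseteq> \<A> \<and> partition_on T P"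

definition countable_partition :: "'a set \<Rightarrow> 'a set set \<Rightarrow> 'a set set \<Rightarrow> bool" where
  "countable_partition T \<A> P \<longleftrightarrow> countable P \<and> P \<subseteq> \<A> \<and> partition_on T P"

definition has_gould_integral ::
  "'a set \<Rightarrow> 'a set set \<Rightarrow> ('a set \<Rightarrow> real) \<Rightarrow> ('a \<Rightarrow> real) \<Rightarrow> real \<Rightarrow> bool" where
  "has_gould_integral T \<A> m f a \<longleftrightarrow>
     (\<forall>\<epsilon>>0. \<exists>P\<^sub>\<epsilon>. finite_partition T \<A> P\<^sub>\<epsilon> \<and>
        (\<forall>P. finite_partition T \<A> P \<and> refines T P P\<^sub>\<epsilon> \<longrightarrow>
           (\<forall>t. (\<forall>A\<in>P. t A \<in> A) \<longrightarrow> \<bar>(\<Sum>A\<in>P. f (t A) * m A) - a\<bar> < \<epsilon>)))"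

definition gould_integrable ::
  "'a set \<Rightarrow> 'a set set \<Rightarrow> ('a set \<Rightarrow> real) \<Rightarrow> ('a \<Rightarrow> real) \<Rightarrow> bool" where
  "gould_integrable T \<A> m f \<longleftrightarrow> (\<exists>a. has_gould_integral T \<A> m f a)"

definition gould_integral ::
  "'a set \<Rightarrow> 'a set set \<Rightarrow> ('a set \<Rightarrow> real) \<Rightarrow> ('a \<Rightarrow> real) \<Rightarrow> real" where
  "gould_integral T \<A> m f = (THE a. has_gould_integral T \<A> m f a)"

text \<open>
  An absolutely convergent real series converges to the same sum in every order, so the series over
  a countable partition is a sum over the unordered index set \<open>P\<close>, with no enumeration of
  \<open>P\<close>.
\<close>

definition has_rl_integral ::
  "'a set \<Rightarrow> 'a set set \<Rightarrow> ('a set \<Rightarrow> real) \<Rightarrow> ('a \<Rightarrow> real) \<Rightarrow> real \<Rightarrow> bool" where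
  "has_rl_integral T \<A> m f b \<longleftrightarrow>
     (\<forall>\<epsilon>>0. \<exists>P\<^sub>\<epsilon>. countable_partition T \<A> P\<^sub>\<epsilon> \<and>
        (\<forall>P. countable_partition T \<A> P \<and> refines T P P\<^sub>\<epsilon> \<longrightarrow>
           (\<forall>A\<in>P. m A > 0 \<longrightarrow> bounded (f ` A)) \<and>
           (\<forall>t. (\<forall>A\<in>P. t A \<in> A) \<longrightarrow>
              (\<lambda>A. \<bar>f (t A) * m A\<bar>) summable_on P \<and>
              \<bar>(\<Sum>\<^sub>\<infinity>A\<in>P. f (t A) * m A) - b\<bar> < \<epsilon>)))"

definition rl_integrable ::
  "'a set \<Rightarrow> 'a set set \<Rightarrow> ('a set \<Rightarrow> real) \<Rightarrow> ('a \<Rightarrow> real) \<Rightarrow> bool" where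
  "rl_integrable T \<A> m f \<longleftrightarrow> (\<exists>b. has_rl_integral T \<A> m f b)"

definition rl_integral ::
  "'a set \<Rightarrow> 'a set set \<Rightarrow> ('a set \<Rightarrow> real) \<Rightarrow> ('a \<Rightarrow> real) \<Rightarrow> real" where
  "rl_integral T \<A> m f = (THE b. has_rl_integral T \<A> m f b)"

end

theory Submission
  imports Defs
begin

text \<open>
  For a bounded \<open>f\<close> the two integrals agree because, by countable additivity, a countable partition
  is a finite one up to a set of small measure, and a set of small measure contributes little to any
  sum.  Precisely, let \<open>\<bar>f\<bar> \<le> K\<close> and let \<open>P\<close>, \<open>P'\<close> be countable partitions whose common blocks
  cover everything outside a set of measure \<open>\<delta>\<close>.  Riemann sums over \<open>P\<close> and \<open>P'\<close> that use the
  same points in the common blocks differ only in the remaining blocks, hence by at most \<open>2 K \<delta>\<close>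
  (lemma \<open>weighted_sums_close\<close>).  So a bound that holds for all Riemann sums over \<open>P'\<close> passes to
  all Riemann sums over \<open>P\<close> (lemma \<open>riemann_sum_transfer\<close>).

  It remains to find such partners for partitions of the two kinds.

  If \<open>a\<close> is the Gould integral and \<open>P\<close> is a countable partition finer than a finite partition \<open>Q\<close>,
  then \<open>P\<close> has finitely many blocks that cover all but a small set \<open>R\<close>; together with the traces of
  \<open>Q\<close> on \<open>R\<close> they form a finite partition, still finer than \<open>Q\<close> (lemma \<open>finite_truncation\<close>).
  If \<open>a\<close> is the Riemann-Lebesgue integral with the countable partition \<open>Q\<close>, truncating \<open>Q\<close>
  itself gives a finite partition \<open>Q'\<close>; for a finite partition \<open>P\<close> finer than \<open>Q'\<close>, the common
  refinement of \<open>P\<close> and \<open>Q\<close> is a countable partition finer than \<open>Q\<close> that alters \<open>P\<close> only inside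
  the small set (lemma \<open>common_refinement_preserves_blocks\<close>).

  Thus the same numbers are integrals in the two senses (theorem \<open>has_gould_iff_has_rl\<close>), which
  yields both the equivalence of integrability and the equality of the integrals.
\<close>

section \<open>Weighted sums over countable partitions\<close>

text \<open>The bridge from the sequential form of countable additivity to unordered sums over a family of
  sets; an infinite family is enumerated.\<close>

lemma (in finite_measure) has_sum_measure_Union:
  assumes P: "countable P" "P \<subseteq> sets M" "disjoint P"
  shows "(measure M has_sum measure M (\<Union>P)) P"
proof (cases "finite P")
  case True
  then have "measure M (\<Union>P) = sum (measure M) P"
    using P by (intro measure_Union') (auto simp: fmeasurable_eq_sets pairwise_def)
  with True show ?thesis
    by (simp add: has_sum_finiteI)
next
  case False
  define e where "e = from_nat_into P"
  have e: "bij_betw e UNIV P"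
    unfolding e_def using P(1) False by (rule bij_betw_from_nat_into)
  then have ran: "range e = P"
    by (rule bij_betw_imp_surj_on)
  have "disjoint_family e"
    using P(3) e ran unfolding disjoint_family_on_def
    by (metis disjointD bij_betw_imp_inj_on injD rangeI)
  then have "(\<lambda>i. measure M (e i)) sums measure M (\<Union>i. e i)"
    using P(2) ran by (intro finite_measure_UNION) auto
  then have "((\<lambda>i. measure M (e i)) has_sum measure M (\<Union>P)) UNIV"
    unfolding ran by (rule sums_nonneg_imp_has_sum) simp
  then show ?thesis
    using has_sum_reindex_bij_betw[OF e] by blast
qed

lemma (in finite_measure) weighted_abs_summable:
  assumes P: "countable P" "P \<subseteq> sets M" "disjoint P"
    and g: "\<And>A. A \<in> P \<Longrightarrow> \<bar>g A\<bar> \<le> K"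
  shows "(\<lambda>A. \<bar>g A * measure M A\<bar>) summable_on P"
proof -
  have "(\<lambda>A. K * measure M A) summable_on P"
    using has_sum_measure_Union[OF P] has_sum_cmult_right summable_on_def by blast
  then have "(\<lambda>A. norm (g A * measure M A)) summable_on P"
    by (rule Infinite_Sum.abs_summable_on_comparison_test') (auto simp: abs_mult g intro!: mult_right_mono)
  then show ?thesis by simp
qed

lemma (in finite_measure) weighted_sum_bound:
  assumes P: "countable P" "P \<subseteq> sets M" "disjoint P"
    and g: "\<And>A. A \<in> P \<Longrightarrow> \<bar>g A\<bar> \<le> K"
  shows "\<bar>\<Sum>\<^sub>\<infinity>A\<in>P. g A * measure M A\<bar> \<le> K * measure M (\<Union>P)"
proof -
  have "(\<lambda>A. g A * measure M A) summable_on P"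
    using weighted_abs_summable[OF P g] summable_on_iff_abs_summable_on_real by fastforce
  then have "norm (\<Sum>\<^sub>\<infinity>A\<in>P. g A * measure M A) \<le> K * measure M (\<Union>P)"
    using has_sum_cmult_right[OF has_sum_measure_Union[OF P]]
    by (rule norm_infsum_le[OF has_sum_infsum]) (auto simp: abs_mult g intro!: mult_right_mono)
  then show ?thesis by simp
qed

text \<open>The contributions of the common blocks cancel, and each partition contributes at most
  \<open>K * \<delta>\<close> from its remaining blocks, as these lie in the part not covered by common blocks.\<close>

lemma (in finite_measure) weighted_sums_close:
  assumes P: "countable_partition (space M) (sets M) P"
    and P': "countable_partition (space M) (sets M) P'"
    and g: "\<And>A. A \<in> P \<union> P' \<Longrightarrow> \<bar>g A\<bar> \<le> K" and "K \<ge> 0"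
    and small: "measure M (space M - \<Union>(P \<inter> P')) \<le> \<delta>"
  shows "\<bar>(\<Sum>\<^sub>\<infinity>A\<in>P. g A * measure M A) - (\<Sum>\<^sub>\<infinity>A\<in>P'. g A * measure M A)\<bar> \<le> 2 * K * \<delta>"
proof -
  let ?S = "\<lambda>P. \<Sum>\<^sub>\<infinity>A\<in>P. g A * measure M A"
  have rest: "?S X = ?S (X \<inter> Y) + ?S (X - Y) \<and> \<bar>?S (X - Y)\<bar> \<le> K * \<delta>"
    if X: "countable_partition (space M) (sets M) X" and gX: "\<And>A. A \<in> X \<Longrightarrow> \<bar>g A\<bar> \<le> K"
      and sm: "measure M (space M - \<Union>(X \<inter> Y)) \<le> \<delta>" for X Y
  proof -
    have cX: "countable X" "X \<subseteq> sets M" "disjoint X" and UX: "\<Union>X = space M"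
      using X by (auto simp: countable_partition_def partition_on_def)
    have sub: "countable Z \<and> Z \<subseteq> sets M \<and> disjoint Z" if "Z \<subseteq> X" for Z
      using cX that by (meson countable_subset pairwise_subset subset_trans)
    have summ: "(\<lambda>A. g A * measure M A) summable_on Z" if "Z \<subseteq> X" for Z
      using weighted_abs_summable[of Z g K] sub[OF that] gX that
        summable_on_iff_abs_summable_on_real[of "\<lambda>A. g A * measure M A" Z] by auto
    have "?S ((X \<inter> Y) \<union> (X - Y)) = ?S (X \<inter> Y) + ?S (X - Y)"
      by (rule infsum_Un_disjoint) (auto intro: summ)
    then have split: "?S X = ?S (X \<inter> Y) + ?S (X - Y)"
      by (simp add: Int_Diff_Un)
    have "\<bar>?S (X - Y)\<bar> \<le> K * measure M (\<Union>(X - Y))"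
      using sub[of "X - Y"] gX by (intro weighted_sum_bound) auto
    also have "measure M (\<Union>(X - Y)) \<le> measure M (space M - \<Union>(X \<inter> Y))"
    proof (rule finite_measure_mono)
      show "\<Union>(X - Y) \<subseteq> space M - \<Union>(X \<inter> Y)"
        using UX cX(3) by (fastforce simp: disjoint_def)
      have "\<Union>(X \<inter> Y) \<in> sets M"
        using sub[of "X \<inter> Y"] by (intro sets.countable_Union) auto
      then show "space M - \<Union>(X \<inter> Y) \<in> sets M" by auto
    qed
    finally show ?thesis
      using split sm \<open>K \<ge> 0\<close> by (meson mult_left_mono order_trans)
  qed
  show ?thesis
    using rest[OF P, of P'] rest[OF P', of P] g small by (simp add: Int_commute abs_le_iff)
qed

text \<open>Riemann sums over \<open>P\<close> inherit a bound for those over \<open>P'\<close>: the given points of the common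
  blocks are completed by arbitrary points to a choice of points for \<open>P'\<close>.\<close>

lemma (in finite_measure) riemann_sum_transfer:
  assumes P: "countable_partition (space M) (sets M) P"
    and P': "countable_partition (space M) (sets M) P'"
    and K: "K > 0" "\<And>x. x \<in> space M \<Longrightarrow> \<bar>f x\<bar> \<le> K"
    and small: "measure M (space M - \<Union>(P \<inter> P')) \<le> \<epsilon> / (4 * K)"
    and P'_sums: "\<And>t. (\<forall>A\<in>P'. t A \<in> A) \<Longrightarrow>
          \<bar>(\<Sum>\<^sub>\<infinity>A\<in>P'. f (t A) * measure M A) - a\<bar> < \<epsilon> / 2"
    and t: "\<forall>A\<in>P. t A \<in> A"
  shows "\<bar>(\<Sum>\<^sub>\<infinity>A\<in>P. f (t A) * measure M A) - a\<bar> < \<epsilon>"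
proof -
  define s where "s A = (if A \<in> P then t A else SOME x. x \<in> A)" for A
  have ne: "A \<noteq> {}" and sub: "A \<subseteq> space M" if "A \<in> P \<union> P'" for A
    using P P' that by (auto simp: countable_partition_def partition_on_def)
  have s: "s A \<in> A" if "A \<in> P \<union> P'" for A
    using t ne[OF that] by (auto simp: s_def some_in_eq)
  have "\<bar>(\<Sum>\<^sub>\<infinity>A\<in>P. f (s A) * measure M A) - (\<Sum>\<^sub>\<infinity>A\<in>P'. f (s A) * measure M A)\<bar>
      \<le> 2 * K * (\<epsilon> / (4 * K))"
    using P P' _ _ small by (rule weighted_sums_close) (use K s sub in \<open>auto intro!: K(2)\<close>)
  moreover have "2 * K * (\<epsilon> / (4 * K)) = \<epsilon> / 2"
    using K(1) by simp
  moreover have "\<bar>(\<Sum>\<^sub>\<infinity>A\<in>P'. f (s A) * measure M A) - a\<bar> < \<epsilon> / 2"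
    using s by (intro P'_sums) auto
  moreover have "(\<Sum>\<^sub>\<infinity>A\<in>P. f (s A) * measure M A) = (\<Sum>\<^sub>\<infinity>A\<in>P. f (t A) * measure M A)"
    by (intro infsum_cong) (simp add: s_def)
  ultimately show ?thesis by linarith
qed

section \<open>Partitions with large common part\<close>

text \<open>Since the measures of the blocks of \<open>P\<close> add up to the total measure, finitely many blocks
  miss little.  What they miss is not made a single block but cut along \<open>Q\<close>, to stay finer
  than \<open>Q\<close>.\<close>

lemma (in finite_measure) finite_truncation:
  assumes P: "countable_partition (space M) (sets M) P"
    and Q: "finite_partition (space M) (sets M) Q"
    and ref: "refines (space M) P Q"
    and "\<delta> > 0"
  obtains P' where "finite_partition (space M) (sets M) P'" "refines (space M) P' Q"
    "measure M (space M - \<Union>(P \<inter> P')) \<le> \<delta>"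
proof -
  have cP: "countable P" "P \<subseteq> sets M" "disjoint P" and UP: "\<Union>P = space M"
    and neP: "{} \<notin> P"
    using P by (auto simp: countable_partition_def partition_on_def)
  have fQ: "finite Q" "Q \<subseteq> sets M" "disjoint Q" and UQ: "\<Union>Q = space M"
    using Q by (auto simp: finite_partition_def partition_on_def)
  obtain F where F: "finite F" "F \<subseteq> P" "dist (sum (measure M) F) (measure M (space M)) \<le> \<delta>"
    using has_sum_finite_approximation[OF has_sum_measure_Union[OF cP] \<open>\<delta> > 0\<close>] UP by auto
  have UF: "\<Union>F \<in> sets M"
    using F cP by (intro sets.finite_Union) auto
  have "measure M (\<Union>F) = sum (measure M) F"
    using F(1,2) cP
    by (intro measure_Union') (auto simp: fmeasurable_eq_sets intro: pairwise_subset)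
  then have small: "measure M (space M - \<Union>F) \<le> \<delta>"
    using F(3) finite_measure_compl[OF UF] by (simp add: dist_real_def abs_le_iff)
  define R where "R = space M - \<Union>F"
  define P' where "P' = F \<union> ((\<inter>) R ` Q - {{}})"
  have "R \<in> sets M"
    using UF by (auto simp: R_def)
  have part: "partition_on (space M) P'"
  proof (rule partition_onI)
    have "\<Union>((\<inter>) R ` Q - {{}}) = R \<inter> space M"
      using UQ by blast
    moreover have "\<Union>F \<subseteq> space M"
      using F(2) UP by blast
    ultimately show "\<Union>P' = space M"
      by (auto simp: P'_def R_def)
    show "{} \<notin> P'"
      using F(2) neP by (auto simp: P'_def)
    have FF: "disjnt p q" if "p \<in> F" "q \<in> F" "p \<noteq> q" for p q
      using that F(2) cP(3) by (meson pairwiseD subsetD)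
    have FR: "disjnt p (R \<inter> q)" "disjnt (R \<inter> q) p" if "p \<in> F" for p q
      using that by (auto simp: disjnt_iff R_def)
    have RR: "disjnt (R \<inter> p) (R \<inter> q)" if "p \<in> Q" "q \<in> Q" "R \<inter> p \<noteq> R \<inter> q" for p q
      using that fQ(3) by (fastforce simp: disjnt_iff disjoint_def)
    have blocks: "X \<in> F \<or> (\<exists>B\<in>Q. X = R \<inter> B)" if "X \<in> P'" for X
      using that by (auto simp: P'_def)
    show "disjnt p q" if "p \<in> P'" "q \<in> P'" "p \<noteq> q" for p q
      using blocks[OF that(1)] blocks[OF that(2)] that(3)
      by (elim disjE bexE) (simp_all only: FF FR RR not_False_eq_True)
  qed
  show ?thesis
  proof
    show "finite_partition (space M) (sets M) P'"
      using part F(1,2) fQ cP \<open>R \<in> sets M\<close> by (auto simp: finite_partition_def P'_def)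
    show "refines (space M) P' Q"
      using ref part F(2) unfolding refines_def P'_def by blast
    have "measure M (space M - \<Union>(P \<inter> P')) \<le> measure M R"
    proof (rule finite_measure_mono[OF _ \<open>R \<in> sets M\<close>])
      show "space M - \<Union>(P \<inter> P') \<subseteq> R"
        using F(2) by (auto simp: R_def P'_def)
    qed
    with small show "measure M (space M - \<Union>(P \<inter> P')) \<le> \<delta>"
      by (simp add: R_def)
  qed
qed

lemma countable_partition_common_refinement:
  assumes P: "countable_partition (space M) (sets M) P"
    and Q: "countable_partition (space M) (sets M) Q"
  shows "countable_partition (space M) (sets M) (common_refinement {P, Q})"
proof -
  have "common_refinement {P, Q} \<subseteq> (\<lambda>(A, B). A \<inter> B) ` (P \<times> Q)"
    by (auto simp: common_refinement Pi_iff)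
  moreover have "countable ((\<lambda>(A, B). A \<inter> B) ` (P \<times> Q))"
    using P Q by (auto simp: countable_partition_def)
  moreover have "(\<lambda>(A, B). A \<inter> B) ` (P \<times> Q) \<subseteq> sets M"
    using P Q by (auto simp: countable_partition_def)
  moreover have "partition_on (space M) (common_refinement {P, Q})"
    using P Q by (intro partition_on_common_refinement) (auto simp: countable_partition_def)
  ultimately show ?thesis
    unfolding countable_partition_def by (meson countable_subset subset_trans)
qed

text \<open>A block of \<open>P\<close> inside a common block of \<open>Q\<close> and \<open>Q'\<close> is not cut by \<open>Q\<close>, so it survives in the
  common refinement; since \<open>P\<close> is finer than \<open>Q'\<close>, such blocks fill the common blocks of
  \<open>Q\<close> and \<open>Q'\<close>.\<close>

lemma common_refinement_preserves_blocks:
  assumes ref: "refines T P Q'"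
  shows "\<Union>(Q \<inter> Q') \<subseteq> \<Union>(P \<inter> common_refinement {P, Q})"
proof
  fix x assume "x \<in> \<Union>(Q \<inter> Q')"
  then obtain B where B: "B \<in> Q" "B \<in> Q'" "x \<in> B" by auto
  have "\<Union>{A \<in> P. A \<subseteq> B} = B"
    using refines_obtains_subset[OF ref B(2)] by (simp add: partition_on_def)
  then obtain A where A: "A \<in> P" "A \<subseteq> B" "x \<in> A"
    using B(3) by blast
  \<comment> \<open>The selector picks \<open>B\<close> from \<open>Q\<close> and \<open>A\<close> from \<open>P\<close>, with \<open>A\<close> from both if \<open>P = Q\<close>.\<close>
  define h where "h X = (if X = P then A else B)" for X
  have "\<Inter>(h ` {P, Q}) = A" "h \<in> (\<Pi> X\<in>{P, Q}. X)"
    using A B by (auto simp: h_def)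
  then have "A \<in> common_refinement {P, Q}"
    using A(3) unfolding common_refinement by blast
  with A show "x \<in> \<Union>(P \<inter> common_refinement {P, Q})" by blast
qed

lemma finite_partition_imp_countable:
  "finite_partition T \<A> P \<Longrightarrow> countable_partition T \<A> P"
  by (auto simp: finite_partition_def countable_partition_def intro: countable_finite)

section \<open>The Gould and Riemann-Lebesgue integrals\<close>

lemma (in finite_measure) has_gould_imp_has_rl:
  assumes K: "K > 0" "\<And>x. x \<in> space M \<Longrightarrow> \<bar>f x\<bar> \<le> K"
    and gould: "has_gould_integral (space M) (sets M) (measure M) f a"
  shows "has_rl_integral (space M) (sets M) (measure M) f a"
  unfolding has_rl_integral_def
proof (intro allI impI)
  fix \<epsilon> :: real assume "\<epsilon> > 0"
  then obtain Q where Q: "finite_partition (space M) (sets M) Q"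
    and Q_sums: "\<And>P t. finite_partition (space M) (sets M) P \<Longrightarrow> refines (space M) P Q \<Longrightarrow>
      \<forall>A\<in>P. t A \<in> A \<Longrightarrow> \<bar>(\<Sum>A\<in>P. f (t A) * measure M A) - a\<bar> < \<epsilon> / 2"
    using gould unfolding has_gould_integral_def by (meson half_gt_zero)
  have "(\<forall>A\<in>P. measure M A > 0 \<longrightarrow> bounded (f ` A)) \<and>
      (\<forall>t. (\<forall>A\<in>P. t A \<in> A) \<longrightarrow> (\<lambda>A. \<bar>f (t A) * measure M A\<bar>) summable_on P \<and>
        \<bar>(\<Sum>\<^sub>\<infinity>A\<in>P. f (t A) * measure M A) - a\<bar> < \<epsilon>)"
    if P: "countable_partition (space M) (sets M) P" and ref: "refines (space M) P Q" for P
  proof (intro conjI ballI allI impI)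
    have cP: "countable P" "P \<subseteq> sets M" "disjoint P" and UP: "\<Union>P = space M"
      using P by (auto simp: countable_partition_def partition_on_def)
    show "bounded (f ` A)" if "A \<in> P" for A
      using that UP K(2) by (intro boundedI[of _ K]) auto
    fix t assume t: "\<forall>A\<in>P. t A \<in> A"
    show "(\<lambda>A. \<bar>f (t A) * measure M A\<bar>) summable_on P"
      using cP by (rule weighted_abs_summable[of _ _ K]) (use t UP in \<open>auto intro!: K(2)\<close>)
    have "\<epsilon> / (4 * K) > 0"
      using \<open>\<epsilon> > 0\<close> K(1) by simp
    with P Q ref obtain P' where P': "finite_partition (space M) (sets M) P'"
      "refines (space M) P' Q" "measure M (space M - \<Union>(P \<inter> P')) \<le> \<epsilon> / (4 * K)"
      by (rule finite_truncation)
    have "finite P'"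
      using P'(1) by (simp add: finite_partition_def)
    then show "\<bar>(\<Sum>\<^sub>\<infinity>A\<in>P. f (t A) * measure M A) - a\<bar> < \<epsilon>"
      using riemann_sum_transfer[where f = f and a = a, OF P finite_partition_imp_countable[OF P'(1)] K P'(3) _ t]
        Q_sums[OF P'(1,2)] by simp
  qed
  then show "\<exists>Q. countable_partition (space M) (sets M) Q \<and>
      (\<forall>P. countable_partition (space M) (sets M) P \<and> refines (space M) P Q \<longrightarrow>
        (\<forall>A\<in>P. measure M A > 0 \<longrightarrow> bounded (f ` A)) \<and>
        (\<forall>t. (\<forall>A\<in>P. t A \<in> A) \<longrightarrow> (\<lambda>A. \<bar>f (t A) * measure M A\<bar>) summable_on P \<and>
          \<bar>(\<Sum>\<^sub>\<infinity>A\<in>P. f (t A) * measure M A) - a\<bar> < \<epsilon>))"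
    using finite_partition_imp_countable[OF Q] by blast
qed

lemma (in finite_measure) has_rl_imp_has_gould:
  assumes ne: "space M \<noteq> {}"
    and K: "K > 0" "\<And>x. x \<in> space M \<Longrightarrow> \<bar>f x\<bar> \<le> K"
    and rl: "has_rl_integral (space M) (sets M) (measure M) f a"
  shows "has_gould_integral (space M) (sets M) (measure M) f a"
  unfolding has_gould_integral_def
proof (intro allI impI)
  fix \<epsilon> :: real assume "\<epsilon> > 0"
  then obtain Q where Q: "countable_partition (space M) (sets M) Q"
    and Q_sums: "\<And>P t. countable_partition (space M) (sets M) P \<Longrightarrow> refines (space M) P Q \<Longrightarrow>
      \<forall>A\<in>P. t A \<in> A \<Longrightarrow> \<bar>(\<Sum>\<^sub>\<infinity>A\<in>P. f (t A) * measure M A) - a\<bar> < \<epsilon> / 2"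
    using rl unfolding has_rl_integral_def by (meson half_gt_zero)
  have partQ: "partition_on (space M) Q"
    using Q by (simp add: countable_partition_def)
  \<comment> \<open>\<open>Q'\<close> has to be finite and close to \<open>Q\<close> but finer than nothing in particular, so the truncation
    is taken relative to the one-block partition.\<close>
  have "finite_partition (space M) (sets M) {space M}" "refines (space M) Q {space M}"
    using partQ ne
    by (auto simp: finite_partition_def refines_def partition_on_space partition_on_def)
  moreover have "\<epsilon> / (4 * K) > 0"
    using \<open>\<epsilon> > 0\<close> K(1) by simp
  ultimately obtain Q' where Q': "finite_partition (space M) (sets M) Q'"
    and small: "measure M (space M - \<Union>(Q \<inter> Q')) \<le> \<epsilon> / (4 * K)"
    using finite_truncation[OF Q] by metis
  have "\<bar>(\<Sum>A\<in>P. f (t A) * measure M A) - a\<bar> < \<epsilon>"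
    if P: "finite_partition (space M) (sets M) P" and ref: "refines (space M) P Q'"
      and t: "\<forall>A\<in>P. t A \<in> A" for P t
  proof -
    let ?P' = "common_refinement {P, Q}"
    have cP: "countable_partition (space M) (sets M) P"
      using P by (rule finite_partition_imp_countable)
    have P': "countable_partition (space M) (sets M) ?P'"
      using cP Q by (rule countable_partition_common_refinement)
    have refQ: "refines (space M) ?P' Q"
      using cP partQ by (intro refines_common_refinement) (auto simp: countable_partition_def)
    have "\<Union>(Q \<inter> Q') \<in> sets M"
      using Q by (intro sets.countable_Union) (auto simp: countable_partition_def)
    then have "measure M (space M - \<Union>(P \<inter> ?P')) \<le> measure M (space M - \<Union>(Q \<inter> Q'))"
      using common_refinement_preserves_blocks[OF ref, of Q]
      by (intro finite_measure_mono) auto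
    then have "measure M (space M - \<Union>(P \<inter> ?P')) \<le> \<epsilon> / (4 * K)"
      using small by linarith
    then have "\<bar>(\<Sum>\<^sub>\<infinity>A\<in>P. f (t A) * measure M A) - a\<bar> < \<epsilon>"
      using riemann_sum_transfer[where f = f and a = a, OF cP P' K _ _ t] Q_sums[OF P' refQ] by simp
    then show ?thesis
      using P by (simp add: finite_partition_def)
  qed
  with Q' show "\<exists>Q. finite_partition (space M) (sets M) Q \<and>
      (\<forall>P. finite_partition (space M) (sets M) P \<and> refines (space M) P Q \<longrightarrow>
        (\<forall>t. (\<forall>A\<in>P. t A \<in> A) \<longrightarrow> \<bar>(\<Sum>A\<in>P. f (t A) * measure M A) - a\<bar> < \<epsilon>))"
    by blast
qed

theorem (in finite_measure) has_gould_iff_has_rl: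
  assumes "space M \<noteq> {}" and "bounded (f ` space M)"
  shows "has_gould_integral (space M) (sets M) (measure M) f a \<longleftrightarrow>
    has_rl_integral (space M) (sets M) (measure M) f a"
proof -
  obtain K where "K > 0" "\<And>x. x \<in> space M \<Longrightarrow> \<bar>f x\<bar> \<le> K"
    using assms(2) by (auto simp: bounded_pos)
  with assms(1) show ?thesis
    using has_gould_imp_has_rl has_rl_imp_has_gould by blast
qed

theorem proposition4p5:
  fixes M :: "'a measure" and f :: "'a \<Rightarrow> real"
  assumes "infinite (space M)"
    and "finite_measure M"
    and "complete_measure M"
    and "finite_variation (space M) (sets M) (measure M)"
    and "bounded (f ` space M)"
  shows "(gould_integrable (space M) (sets M) (measure M) f \<longleftrightarrow>
            rl_integrable (space M) (sets M) (measure M) f) \<and>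
         (gould_integrable (space M) (sets M) (measure M) f \<longrightarrow>
            gould_integral (space M) (sets M) (measure M) f =
            rl_integral (space M) (sets M) (measure M) f)"
proof -
  have "space M \<noteq> {}"
    using assms(1) by auto
  with assms(2,5)
  have "has_gould_integral (space M) (sets M) (measure M) f =
      has_rl_integral (space M) (sets M) (measure M) f"
    by (intro ext finite_measure.has_gould_iff_has_rl)
  then show ?thesis
    by (simp add: gould_integrable_def rl_integrable_def gould_integral_def rl_integral_def)
qed

end
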